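(* Let $\chi$ be a nonlinear kernel with data $(L,\psi,\alpha,\beta)$ relative to $\Pi=(t_k)_{k\in\mathbb{Z}}$, and let $f:\mathbb{R}^+\to\mathbb{R}$ be a bounded measurable function. Then $$\lim_{w\to+\infty}(K^\chi_w f)(x)=f(x)$$ at every point $x\in\mathbb{R}^+$ at which $f$ is continuous. Moreover, if $f\in\mathcal{C}(\mathbb{R}^+)$, then $$\lim_{w\to+\infty}\|K^\chi_w f-f\|_\infty=0.$$
   Context: Notation: $\mathbb{R}^+=(0,\infty)$, $\mathbb{R}^+_0=[0,\infty)$; $\mu$ is the logarithmic (Haar) measure $\mu(A)=\int_A \frac{dt}{t}$ on $\mathbb{R}^+$, and $L^1_\mu(\mathbb{R}^+)$ the corresponding Lebesgue space; $\|\cdot\|_\infty$ is the sup norm on $\mathbb{R}^+$. $\mathcal{C}(\mathbb{R}^+)$ is the space of bounded functions $f:\mathbb{R}^+\to\mathbb{R}$ that are log-uniformly continuous: for every $\varepsilon>0$ there is $\delta'>0$ such that $|f(u)-f(v)|<\varepsilon$ whenever $u,v\in\mathbb{R}^+$, $|\ln u-\ln v|\le\delta'$. $\Pi=(t_k)_{k\in\mathbb{Z}}$ is a sequence of real numbers with $t_k<t_{k+1}$, $\lim_{k\to\pm\infty}t_k=\pm\infty$, for which there are constants $\Delta,\delta>0$ with $\delta\le\Delta_k:=t_{k+1}-t_k\le\Delta$ for every $k\in\mathbb{Z}$. A nonlinear kernel with data $(L,\psi,\alpha,\beta)$, where $L:\mathbb{R}^+\to\mathbb{R}^+_0$ is measurable,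 $\psi:\mathbb{R}^+_0\to\mathbb{R}^+_0$ is non-decreasing and continuous with $\psi(0)=0$, and $\alpha,\beta>0$, is a function $\chi:\mathbb{R}^+\times\mathbb{R}\to\mathbb{R}$ such that: (1) $(\chi(e^{-t_k}x^w,u))_k\in\ell^1(\mathbb{Z})$ for every $x\in\mathbb{R}^+$, $u\in\mathbb{R}$, $w>0$; (2) $\chi(x,0)=0$ for every $x\in\mathbb{R}^+$; (3) $|\chi(x,u)-\chi(x,v)|\le L(x)\,\psi(|u-v|)$ for every $x\in\mathbb{R}^+$, $u,v\in\mathbb{R}$; (4) for every $j\in\mathbb{N}$ ($j\ge1$), $$\mathcal{S}^j_w(x):=\sup_{0\le|u|<1/j}\Big|\sum_{k\in\mathbb{Z}}\chi(e^{-t_k}x^w,u)-u\Big|=\mathcal{O}(w^{-\alpha}),\qquad \mathcal{T}^j_w(x):=\sup_{|u|\ge1/j}\Big|\frac1u\sum_{k\in\mathbb{Z}}\chi(e^{-t_k}x^w,u)-1\Big|=\mathcal{O}(w^{-\alpha})$$ as $w\to+\infty$, uniformly with respect to $x\in\mathbb{R}^+$; (5) $L\in L^1_\mu(\mathbb{R}^+)$ and $L$ is bounded; (6) $M_{\beta,\Pi}(L)<+\infty$, where for $\gamma\ge0$, $M_{\gamma,\Pi}(L):=\sup_{x\in\mathbb{R}^+}\sum_{k\in\mathbb{Z}}L(e^{-t_k}x)\,|\ln x-t_k|^\gamma$ (with $M_{0,\Pi}(L):=\sup_{x}\sum_k L(e^{-t_k}x)$). For $w>0$ and a locally integrable $f:\mathbb{R}^+\to\mathbb{R}$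 for which the series converges for every $x$, the nonlinear exponential Kantorovich sampling operator is $$(K^\chi_w f)(x):=\sum_{k\in\mathbb{Z}}\chi\Big(e^{-t_k}x^w,\ \frac{w}{\Delta_k}\int_{t_k/w}^{t_{k+1}/w}f(e^u)\,du\Big),\qquad x\in\mathbb{R}^+.$$ *)

theory Defs
  imports "HOL-Analysis.Analysis"
begin

text \<open>
  Functions on the positive half-line are total functions on \<open>real\<close> of which only the
  values on \<open>{0<..}\<close> are ever used. Suprema and sums of nonnegative terms
  that may be infinite are taken in \<open>ennreal\<close>, because \<open>Sup\<close> and \<open>infsum\<close> on \<open>real\<close>
  do not express divergence to infinity.
\<close>

definition log_haar :: "real measure" where
  "log_haar = density (lebesgue_on {0<..}) (\<lambda>x. ennreal (1 / x))"

definition sup_norm :: "(real \<Rightarrow> real) \<Rightarrow> ennreal" where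
  "sup_norm g = (SUP x\<in>{0<..}. ennreal \<bar>g x\<bar>)"

definition bounded_log_unif_cont :: "(real \<Rightarrow> real) set" where
  "bounded_log_unif_cont = {f. bounded (f ` {0<..}) \<and>
     (\<forall>\<epsilon>>0. \<exists>\<delta>>0. \<forall>u>0. \<forall>v>0. \<bar>ln u - ln v\<bar> \<le> \<delta> \<longrightarrow> \<bar>f u - f v\<bar> < \<epsilon>)}"

definition sampling_partition :: "(int \<Rightarrow> real) \<Rightarrow> bool" where
  "sampling_partition t \<longleftrightarrow>
     (\<forall>k. t k < t (k + 1)) \<and>
     filterlim t at_top at_top \<and> filterlim t at_bot at_bot \<and>
     (\<exists>\<Delta>>0. \<exists>\<delta>>0. \<forall>k. \<delta> \<le> t (k + 1) - t k \<and> t (k + 1) - t k \<le> \<Delta>)"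

text \<open>
  The case distinction gives the factor \<open>1\<close> for \<open>\<gamma> = 0\<close>, also where \<open>ln x = t k\<close>
  (in the library \<open>0 powr 0 = 0\<close>).
\<close>

definition discrete_moment :: "real \<Rightarrow> (int \<Rightarrow> real) \<Rightarrow> (real \<Rightarrow> real) \<Rightarrow> ennreal" where
  "discrete_moment \<gamma> t L =
     (SUP x\<in>{0<..}. \<Sum>\<^sub>\<infinity>k\<in>UNIV.
        ennreal (L (exp (- t k) * x) * (if \<gamma> = 0 then 1 else \<bar>ln x - t k\<bar> powr \<gamma>)))"

definition kernel_S ::
  "(int \<Rightarrow> real) \<Rightarrow> (real \<Rightarrow> real \<Rightarrow> real) \<Rightarrow> nat \<Rightarrow> real \<Rightarrow> real \<Rightarrow> ennreal" where
  "kernel_S t chi j w x =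
     (SUP u\<in>{u. \<bar>u\<bar> < 1 / real j}.
        ennreal \<bar>(\<Sum>\<^sub>\<infinity>k\<in>UNIV. chi (exp (- t k) * x powr w) u) - u\<bar>)"

definition kernel_T ::
  "(int \<Rightarrow> real) \<Rightarrow> (real \<Rightarrow> real \<Rightarrow> real) \<Rightarrow> nat \<Rightarrow> real \<Rightarrow> real \<Rightarrow> ennreal" where
  "kernel_T t chi j w x =
     (SUP u\<in>{u. 1 / real j \<le> \<bar>u\<bar>}.
        ennreal \<bar>1 / u * (\<Sum>\<^sub>\<infinity>k\<in>UNIV. chi (exp (- t k) * x powr w) u) - 1\<bar>)"

text \<open>
  \<open>unif_bigo_powr F \<alpha>\<close>: \<open>F w x\<close> is \<open>O(w powr - \<alpha>)\<close> as \<open>w\<close> tends to infinity,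
  with one constant and one threshold for all \<open>x > 0\<close>.
\<close>

definition unif_bigo_powr :: "(real \<Rightarrow> real \<Rightarrow> ennreal) \<Rightarrow> real \<Rightarrow> bool" where
  "unif_bigo_powr F \<alpha> \<longleftrightarrow>
     (\<exists>C. \<forall>\<^sub>F w in at_top. \<forall>x>0. F w x \<le> ennreal (C * w powr (- \<alpha>)))"

definition nonlinear_kernel ::
  "(int \<Rightarrow> real) \<Rightarrow> (real \<Rightarrow> real) \<Rightarrow> (real \<Rightarrow> real) \<Rightarrow> real \<Rightarrow> real \<Rightarrow>
     (real \<Rightarrow> real \<Rightarrow> real) \<Rightarrow> bool" where
  "nonlinear_kernel t L \<psi> \<alpha> \<beta> chi \<longleftrightarrow>
     L \<in> borel_measurable (lebesgue_on {0<..}) \<and> (\<forall>x>0. 0 \<le> L x) \<and>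
     (\<forall>u\<ge>0. 0 \<le> \<psi> u) \<and> mono_on {0..} \<psi> \<and> continuous_on {0..} \<psi> \<and> \<psi> 0 = 0 \<and>
     \<alpha> > 0 \<and> \<beta> > 0 \<and>
     (\<forall>x>0. \<forall>u. \<forall>w>0. (\<lambda>k. \<bar>chi (exp (- t k) * x powr w) u\<bar>) summable_on UNIV) \<and>
     (\<forall>x>0. chi x 0 = 0) \<and>
     (\<forall>x>0. \<forall>u v. \<bar>chi x u - chi x v\<bar> \<le> L x * \<psi> \<bar>u - v\<bar>) \<and>
     (\<forall>j\<ge>1. unif_bigo_powr (kernel_S t chi j) \<alpha> \<and> unif_bigo_powr (kernel_T t chi j) \<alpha>) \<and>
     integrable log_haar L \<and> bounded (L ` {0<..}) \<and>
     discrete_moment \<beta> t L < \<infinity>"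

text \<open>
  For a nonlinear kernel and a bounded \<open>f\<close> the series converges absolutely:
  its terms are dominated by a constant multiple of \<open>L (exp (- t k) * x powr w)\<close>,
  which is summable in \<open>k\<close> because \<open>L\<close> is bounded, the points \<open>t k\<close> are separated and the
  discrete moment of order \<open>\<beta>\<close> is finite.
\<close>

definition exp_kantorovich ::
  "(int \<Rightarrow> real) \<Rightarrow> (real \<Rightarrow> real \<Rightarrow> real) \<Rightarrow> real \<Rightarrow> (real \<Rightarrow> real) \<Rightarrow> real \<Rightarrow> real" where
  "exp_kantorovich t chi w f x =
     (\<Sum>\<^sub>\<infinity>k\<in>UNIV. chi (exp (- t k) * x powr w)
        (w / (t (k + 1) - t k) * (LINT u:{t k / w..t (k + 1) / w}|lebesgue. f (exp u))))"

end

(* Write y = x powr w and m k for the mean of f o exp over {t k / w..t (k + 1) / w}. Then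
   K f x - f x splits into the sum over k of chi (exp (- t k) * y) (m k) - chi (exp (- t k) * y) (f x)
   and the error of the kernel on the constant f x; the latter is O(w powr - \<alpha>) uniformly in x by the
   assumptions on S and T with j = 1. The k-th term of the sum is at most
   L (exp (- t k) * y) * \<psi> |m k - f x|. If |ln y - t k| is at most w * \<eta> / 2, then m k is close
   to f x and the sum of L over these k is bounded because the points t k are separated;
   the sum of L over the remaining k is at most (w * \<eta> / 2) powr - \<beta> times the moment
   of order \<beta>. Both limits follow from this one estimate, which is uniform in x. *)

theory Submission
  imports Defs
begin

section \<open>Separated points and finite partial sums of the moment\<close>

lemma int_sequence_gap:
  fixes t :: "int \<Rightarrow> real"
  assumes "\<And>k. \<delta> \<le> t (k + 1) - t k" and "k \<le> l"
  shows "\<delta> * of_int (l - k) \<le> t l - t k"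
  using assms(2)
proof (induction l rule: int_ge_induct)
  case (step i)
  then show ?case using assms(1)[of i] by (simp add: algebra_simps)
qed simp

text \<open>The points \<open>t k\<close> with \<open>k\<close> in \<open>G\<close> lie in an
  interval of length \<open>2 * r\<close> and grow by at least \<open>\<delta>\<close> per step, so
  every index of \<open>G\<close> is within \<open>2 * r / \<delta>\<close> of the least one. The
  summand 1 counts that least index itself.\<close>

lemma card_separated_le:
  fixes t :: "int \<Rightarrow> real"
  assumes gap: "\<And>k. \<delta> \<le> t (k + 1) - t k" and "\<delta> > 0" and "finite G" and "r \<ge> 0"
    and G: "\<And>k. k \<in> G \<Longrightarrow> \<bar>c - t k\<bar> \<le> r"
  shows "real (card G) \<le> 2 * r / \<delta> + 1"
proof (cases "G = {}")
  case True
  then show ?thesis using assms by simp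
next
  case False
  define a where "a = Min G"
  have a: "a \<in> G" "\<And>k. k \<in> G \<Longrightarrow> a \<le> k"
    using False \<open>finite G\<close> by (auto simp: a_def)
  have "G \<subseteq> {a..a + \<lfloor>2 * r / \<delta>\<rfloor>}"
  proof
    fix k assume k: "k \<in> G"
    have "\<delta> * of_int (k - a) \<le> t k - t a"
      using int_sequence_gap[of \<delta> t a k] gap a(2)[OF k] by blast
    also have "\<dots> \<le> 2 * r" using G[OF k] G[OF a(1)] by linarith
    finally have "of_int (k - a) \<le> 2 * r / \<delta>"
      using \<open>\<delta> > 0\<close> by (simp add: field_simps)
    then have "k - a \<le> \<lfloor>2 * r / \<delta>\<rfloor>" by (simp only: le_floor_iff)
    then show "k \<in> {a..a + \<lfloor>2 * r / \<delta>\<rfloor>}" using a(2)[OF k] by simp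
  qed
  then have "card G \<le> card {a..a + \<lfloor>2 * r / \<delta>\<rfloor>}"
    by (intro card_mono) auto
  also have "\<dots> = nat (\<lfloor>2 * r / \<delta>\<rfloor> + 1)" by simp
  finally have "real (card G) \<le> real (nat (\<lfloor>2 * r / \<delta>\<rfloor> + 1))" by linarith
  moreover have "\<lfloor>2 * r / \<delta>\<rfloor> \<ge> 0" using assms by simp
  ultimately show ?thesis by linarith
qed

text \<open>Turns the finite \<open>ennreal\<close> moment into a real bound on finite partial sums,
  so that all later estimates of \<open>L\<close> can be made with finite real sums. Positivity of
  \<gamma> selects the \<open>powr\<close> branch in the definition of the moment.\<close>

lemma discrete_moment_finite_sum:
  assumes "discrete_moment \<gamma> t L < \<infinity>" and "\<gamma> > 0" and nn: "\<And>x. x > 0 \<Longrightarrow> 0 \<le> L x"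
  obtains M where "M \<ge> 0" and "\<And>x F. x > 0 \<Longrightarrow> finite F \<Longrightarrow>
    (\<Sum>k\<in>F. L (exp (- t k) * x) * \<bar>ln x - t k\<bar> powr \<gamma>) \<le> M"
proof -
  obtain M where M: "discrete_moment \<gamma> t L = ennreal M" "M \<ge> 0"
    using assms(1) by (cases "discrete_moment \<gamma> t L") auto
  have "(\<Sum>k\<in>F. L (exp (- t k) * x) * \<bar>ln x - t k\<bar> powr \<gamma>) \<le> M"
    if x: "x > 0" and F: "finite F" for x F
  proof -
    let ?g = "\<lambda>k. L (exp (- t k) * x) * \<bar>ln x - t k\<bar> powr \<gamma>"
    have "ennreal (\<Sum>k\<in>F. ?g k) = (\<Sum>k\<in>F. ennreal (?g k))"
      using nn x by (subst sum_ennreal) auto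
    also have "\<dots> \<le> (\<Sum>\<^sub>\<infinity>k\<in>UNIV. ennreal (?g k))"
      using F by (subst nonneg_infsum_complete) (auto intro!: SUP_upper)
    also have "\<dots> \<le> discrete_moment \<gamma> t L"
      unfolding discrete_moment_def using \<open>\<gamma> > 0\<close> x
      by (intro SUP_upper2[of x]) auto
    finally show ?thesis using M by simp
  qed
  with M(2) show ?thesis using that by blast
qed

section \<open>Means of f o exp over intervals\<close>

text \<open>Since \<open>f\<close> is only Lebesgue measurable, continuity of \<open>exp\<close>
  alone does not give the claim. The preimage of a Borel set under the composition is instead
  written as the image under \<open>ln\<close> of a Lebesgue set, and a differentiable map of the
  line sends Lebesgue sets to Lebesgue sets.\<close>

lemma borel_measurable_lebesgue_comp_exp:
  fixes f :: "real \<Rightarrow> real"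
  assumes "f \<in> borel_measurable (lebesgue_on {0<..})"
  shows "(\<lambda>u. f (exp u)) \<in> borel_measurable lebesgue"
proof (rule measurableI)
  fix A :: "real set" assume "A \<in> sets borel"
  let ?S = "f -` A \<inter> {0<..}"
  have "?S \<in> sets (lebesgue_on {0<..})"
    using measurable_sets[OF assms \<open>A \<in> sets borel\<close>] by simp
  then have "?S \<in> sets lebesgue"
    by (simp add: sets_restrict_space_iff)
  moreover have "ln differentiable_on ?S"
    unfolding differentiable_on_def
    by (auto intro!: differentiable_at_withinI
        differentiableI[OF has_field_derivative_imp_has_derivative[OF DERIV_ln]])
  ultimately have "ln ` ?S \<in> sets lebesgue"
    by (intro differentiable_image_in_sets_lebesgue) auto
  moreover have "ln ` ?S = (\<lambda>u. f (exp u)) -` A \<inter> space lebesgue"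
  proof (intro equalityI subsetI)
    fix u assume "u \<in> (\<lambda>u. f (exp u)) -` A \<inter> space lebesgue"
    then have "exp u \<in> ?S" "u = ln (exp u)" by auto
    then show "u \<in> ln ` ?S" by (rule rev_image_eqI)
  qed auto
  ultimately show "(\<lambda>u. f (exp u)) -` A \<inter> space lebesgue \<in> sets lebesgue" by simp
qed auto

text \<open>The mean of the constant \<open>c\<close> is \<open>c\<close>, so the claim is the
  triangle inequality for the integral of \<open>g u - c\<close>. The bound \<open>M\<close> serves
  to make \<open>g\<close> integrable on the interval.\<close>

lemma interval_mean_close:
  fixes g :: "real \<Rightarrow> real"
  assumes "g \<in> borel_measurable lebesgue" and bd: "\<And>u. \<bar>g u\<bar> \<le> M" and "a < b"
    and close: "\<And>u. u \<in> {a..b} \<Longrightarrow> \<bar>g u - c\<bar> \<le> e"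
  shows "\<bar>1 / (b - a) * (LINT u:{a..b}|lebesgue. g u) - c\<bar> \<le> e"
proof -
  have const: "set_integrable lebesgue {a..b} (\<lambda>_. d)" for d :: real
  proof -
    have "integrable lebesgue (indicator {a..b} :: real \<Rightarrow> real)"
      using \<open>a < b\<close> by (intro integrable_real_indicator) auto
    then show ?thesis unfolding set_integrable_def by simp
  qed
  have int: "set_integrable lebesgue {a..b} g"
  proof (rule set_integrable_bound[OF const[of M]])
    show "set_borel_measurable lebesgue {a..b} g"
      unfolding set_borel_measurable_def
      by (intro borel_measurable_scaleR borel_measurable_indicator assms(1)) auto
    show "AE x in lebesgue. x \<in> {a..b} \<longrightarrow> norm (g x) \<le> norm M"
      using bd by (auto intro!: AE_I2 intro: order_trans[OF _ abs_ge_self])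
  qed
  have cint: "(LINT u:{a..b}|lebesgue. d) = d * (b - a)" for d :: real
    using \<open>a < b\<close> by (simp add: set_lebesgue_integral_def)
  have "(LINT u:{a..b}|lebesgue. g u - c) = (LINT u:{a..b}|lebesgue. g u) - c * (b - a)"
    using set_integral_diff(2)[OF int const] cint by simp
  moreover have "\<bar>LINT u:{a..b}|lebesgue. g u - c\<bar> \<le> (LINT u:{a..b}|lebesgue. \<bar>g u - c\<bar>)"
    using set_integral_norm_bound[OF set_integral_diff(1)[OF int const]] by simp
  moreover have "(LINT u:{a..b}|lebesgue. \<bar>g u - c\<bar>) \<le> (LINT u:{a..b}|lebesgue. e)"
    using set_integrable_norm[OF set_integral_diff(1)[OF int const]] close
    by (intro set_integral_mono const) auto
  ultimately have "\<bar>(LINT u:{a..b}|lebesgue. g u) - c * (b - a)\<bar> \<le> e * (b - a)"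
    using cint by simp
  moreover have "1 / (b - a) * (LINT u:{a..b}|lebesgue. g u) - c
      = ((LINT u:{a..b}|lebesgue. g u) - c * (b - a)) / (b - a)"
    using \<open>a < b\<close> by (simp add: field_simps)
  ultimately show ?thesis
    using \<open>a < b\<close> by (simp add: abs_divide pos_divide_le_eq)
qed

section \<open>The kernel on constants\<close>

text \<open>For \<open>\<bar>u\<bar> < 1\<close> the quantity \<open>kernel_S\<close> controls the
  absolute error; for all other \<open>u\<close>, \<open>kernel_T\<close> controls the relative
  error, which is then multiplied by \<open>\<bar>u\<bar>\<close>. The factor
  \<open>1 + \<bar>u\<bar>\<close> covers both cases.\<close>

lemma kernel_constant_error:
  assumes "unif_bigo_powr (kernel_S t chi 1) \<alpha>" and "unif_bigo_powr (kernel_T t chi 1) \<alpha>"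
  obtains C where "C \<ge> 0" and "\<forall>\<^sub>F w in at_top. \<forall>x>0. \<forall>u.
    \<bar>(\<Sum>\<^sub>\<infinity>k\<in>UNIV. chi (exp (- t k) * x powr w) u) - u\<bar> \<le> (1 + \<bar>u\<bar>) * (C * w powr (- \<alpha>))"
proof -
  obtain C1 where C1: "\<forall>\<^sub>F w in at_top. \<forall>x>0. kernel_S t chi 1 w x \<le> ennreal (C1 * w powr (- \<alpha>))"
    using assms(1) unfolding unif_bigo_powr_def by blast
  obtain C2 where C2: "\<forall>\<^sub>F w in at_top. \<forall>x>0. kernel_T t chi 1 w x \<le> ennreal (C2 * w powr (- \<alpha>))"
    using assms(2) unfolding unif_bigo_powr_def by blast
  \<comment> \<open>The maximum with 0 makes the bound nonnegative, so inequalities in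
    \<open>ennreal\<close> can be read back as real ones; \<open>ennreal\<close> sends negative
    numbers to 0.\<close>
  define C where "C = max 0 (max C1 C2)"
  have C: "C \<ge> 0" "C1 \<le> C" "C2 \<le> C" by (auto simp: C_def)
  have "\<forall>\<^sub>F w in at_top. \<forall>x>0. \<forall>u.
    \<bar>(\<Sum>\<^sub>\<infinity>k\<in>UNIV. chi (exp (- t k) * x powr w) u) - u\<bar> \<le> (1 + \<bar>u\<bar>) * (C * w powr (- \<alpha>))"
    using C1 C2
  proof eventually_elim
    case (elim w)
    show ?case
    proof (intro allI impI)
      fix x u :: real assume x: "x > 0"
      let ?s = "\<Sum>\<^sub>\<infinity>k\<in>UNIV. chi (exp (- t k) * x powr w) u"
      let ?B = "C * w powr (- \<alpha>)"
      have B: "?B \<ge> 0" using C by simp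
      show "\<bar>?s - u\<bar> \<le> (1 + \<bar>u\<bar>) * ?B"
      proof (cases "\<bar>u\<bar> < 1")
        case True
        have "ennreal \<bar>?s - u\<bar> \<le> kernel_S t chi 1 w x"
          unfolding kernel_S_def using True by (intro SUP_upper2[of u]) auto
        also have "\<dots> \<le> ennreal (C1 * w powr (- \<alpha>))" using elim x by blast
        also have "\<dots> \<le> ennreal ?B" using C by (intro ennreal_leI mult_right_mono) auto
        finally have "\<bar>?s - u\<bar> \<le> ?B" using B by simp
        moreover have "0 \<le> \<bar>u\<bar> * ?B" using mult_nonneg_nonneg[OF abs_ge_zero B] .
        ultimately show ?thesis by (simp only: distrib_right mult_1_left)
      next
        case False
        have "ennreal \<bar>1 / u * ?s - 1\<bar> \<le> kernel_T t chi 1 w x"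
          unfolding kernel_T_def using False by (intro SUP_upper2[of u]) auto
        also have "\<dots> \<le> ennreal (C2 * w powr (- \<alpha>))" using elim x by blast
        also have "\<dots> \<le> ennreal ?B" using C by (intro ennreal_leI mult_right_mono) auto
        finally have *: "\<bar>1 / u * ?s - 1\<bar> \<le> ?B" using B by simp
        have "?s - u = u * (1 / u * ?s - 1)" using False by (simp add: field_simps)
        then have "\<bar>?s - u\<bar> = \<bar>u\<bar> * \<bar>1 / u * ?s - 1\<bar>" by (metis abs_mult)
        also have "\<dots> \<le> \<bar>u\<bar> * ?B" using * by (intro mult_left_mono) auto
        finally show ?thesis using B by (simp add: algebra_simps)
      qed
    qed
  qed
  with C(1) show ?thesis using that by blast
qed

section \<open>Finite sums of L along the sampling points\<close>

text \<open>Markov's inequality for the weights \<open>L (exp (- t k) * x)\<close>: on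
  \<open>F\<close> the factor \<open>\<bar>ln x - t k\<bar> powr \<beta>\<close> is at least
  \<open>r powr \<beta>\<close>.\<close>

lemma finite_sum_kernel_far:
  fixes t :: "int \<Rightarrow> real"
  assumes mom: "\<And>x F. x > 0 \<Longrightarrow> finite F \<Longrightarrow>
      (\<Sum>k\<in>F. L (exp (- t k) * x) * \<bar>ln x - t k\<bar> powr \<beta>) \<le> M"
    and "\<beta> > 0" and nn: "\<And>x. x > 0 \<Longrightarrow> 0 \<le> L x" and "x > 0" and "finite F" and "r > 0"
    and far: "\<And>k. k \<in> F \<Longrightarrow> r < \<bar>ln x - t k\<bar>"
  shows "(\<Sum>k\<in>F. L (exp (- t k) * x)) \<le> M * r powr (- \<beta>)"
proof -
  have "r powr \<beta> * (\<Sum>k\<in>F. L (exp (- t k) * x))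
      \<le> (\<Sum>k\<in>F. L (exp (- t k) * x) * \<bar>ln x - t k\<bar> powr \<beta>)"
    unfolding sum_distrib_left
  proof (rule sum_mono)
    fix k assume "k \<in> F"
    then have "r powr \<beta> \<le> \<bar>ln x - t k\<bar> powr \<beta>"
      using far[of k] \<open>\<beta> > 0\<close> \<open>r > 0\<close> by (intro powr_mono2) auto
    then show "r powr \<beta> * L (exp (- t k) * x) \<le> L (exp (- t k) * x) * \<bar>ln x - t k\<bar> powr \<beta>"
      using nn[of "exp (- t k) * x"] \<open>x > 0\<close> by (subst mult.commute) (auto intro: mult_left_mono)
  qed
  also have "\<dots> \<le> M" using mom assms by blast
  finally show ?thesis using \<open>r > 0\<close> by (simp add: powr_minus field_simps)
qed

text \<open>The sum is split at distance 1 from \<open>ln x\<close>. Separation leaves at most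
  \<open>2 / \<delta> + 1\<close> near terms, each at most \<open>H\<close>; the far terms add up to
  at most \<open>M\<close> by the tail bound with \<open>r = 1\<close>.\<close>

lemma finite_sum_kernel_bound:
  fixes t :: "int \<Rightarrow> real"
  assumes mom: "\<And>x F. x > 0 \<Longrightarrow> finite F \<Longrightarrow>
      (\<Sum>k\<in>F. L (exp (- t k) * x) * \<bar>ln x - t k\<bar> powr \<beta>) \<le> M"
    and "\<beta> > 0" and nn: "\<And>x. x > 0 \<Longrightarrow> 0 \<le> L x" and bd: "\<And>x. x > 0 \<Longrightarrow> L x \<le> H"
    and gap: "\<And>k. \<delta> \<le> t (k + 1) - t k" and "\<delta> > 0" and "x > 0" and "finite F"
  shows "(\<Sum>k\<in>F. L (exp (- t k) * x)) \<le> (2 / \<delta> + 1) * H + M"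
proof -
  let ?G = "{k \<in> F. \<bar>ln x - t k\<bar> \<le> 1}"
  have "H \<ge> 0" using nn[of 1] bd[of 1] by simp
  have "(\<Sum>k\<in>?G. L (exp (- t k) * x)) \<le> real (card ?G) * H"
    using bd \<open>x > 0\<close> by (intro sum_bounded_above) auto
  also have "\<dots> \<le> (2 / \<delta> + 1) * H"
  proof (rule mult_right_mono)
    have "real (card ?G) \<le> 2 * 1 / \<delta> + 1"
      by (rule card_separated_le[where t = t and c = "ln x"]) (use gap \<open>\<delta> > 0\<close> \<open>finite F\<close> in auto)
    then show "real (card ?G) \<le> 2 / \<delta> + 1" by simp
  qed fact
  finally have near: "(\<Sum>k\<in>?G. L (exp (- t k) * x)) \<le> (2 / \<delta> + 1) * H" .
  have "(\<Sum>k\<in>F - ?G. L (exp (- t k) * x)) \<le> M * 1 powr (- \<beta>)"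
    by (rule finite_sum_kernel_far[where t = t])
      (use mom nn \<open>\<beta> > 0\<close> \<open>x > 0\<close> \<open>finite F\<close> in auto)
  then show ?thesis
    using near sum.subset_diff[of ?G F "\<lambda>k. L (exp (- t k) * x)"] \<open>finite F\<close> by simp
qed

text \<open>Summability of \<open>a\<close> is not assumed: the bound on finite sums makes the
  difference absolutely summable, and adding \<open>b\<close> recovers \<open>a\<close>. Summability
  has to be settled first because \<open>infsum\<close> is 0 for a family that is not
  summable.\<close>

lemma infsum_diff_le:
  fixes a b :: "'i \<Rightarrow> real"
  assumes "\<And>F. finite F \<Longrightarrow> (\<Sum>k\<in>F. \<bar>a k - b k\<bar>) \<le> B" and b: "(\<lambda>k. \<bar>b k\<bar>) summable_on UNIV"
  shows "\<bar>(\<Sum>\<^sub>\<infinity>k\<in>UNIV. a k) - (\<Sum>\<^sub>\<infinity>k\<in>UNIV. b k)\<bar> \<le> B"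
proof -
  have s: "(\<lambda>k. \<bar>a k - b k\<bar>) summable_on UNIV"
  proof (rule nonneg_bdd_above_summable_on)
    show "bdd_above (sum (\<lambda>k. \<bar>a k - b k\<bar>) ` {F. F \<subseteq> UNIV \<and> finite F})"
      by (rule bdd_aboveI2[of _ _ B]) (use assms(1) in blast)
  qed simp
  have d: "(\<lambda>k. a k - b k) summable_on UNIV"
    using s abs_summable_summable[of "\<lambda>k. a k - b k" UNIV] by (simp only: real_norm_def)
  have b': "b summable_on UNIV"
    using b abs_summable_summable[of b UNIV] by (simp only: real_norm_def)
  have "(\<Sum>\<^sub>\<infinity>k\<in>UNIV. a k) = (\<Sum>\<^sub>\<infinity>k\<in>UNIV. a k - b k) + (\<Sum>\<^sub>\<infinity>k\<in>UNIV. b k)"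
    using infsum_add[OF d b'] by simp
  moreover have "\<bar>\<Sum>\<^sub>\<infinity>k\<in>UNIV. a k - b k\<bar> \<le> (\<Sum>\<^sub>\<infinity>k\<in>UNIV. \<bar>a k - b k\<bar>)"
    using norm_infsum_bound[of "\<lambda>k. a k - b k" UNIV] s by (simp only: real_norm_def)
  moreover have "(\<Sum>\<^sub>\<infinity>k\<in>UNIV. \<bar>a k - b k\<bar>) \<le> B"
    using s assms(1) by (rule infsum_le_finite_sums)
  ultimately show ?thesis by linarith
qed

section \<open>The estimate uniform in x\<close>

text \<open>The order of quantifiers lets one estimate serve both limits. \<open>D\<close> is fixed
  before \<open>e\<close>, so \<open>e\<close> can later be chosen to make
  \<open>\<psi> e * D\<close> small; the threshold for \<open>w\<close> is fixed before
  \<open>x\<close>, and the oscillation of \<open>f\<close> enters only as a premise at the given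
  \<open>x\<close>.\<close>

lemma exp_kantorovich_estimate:
  assumes part: "sampling_partition t" and ker: "nonlinear_kernel t L \<psi> \<alpha> \<beta> chi"
    and meas: "f \<in> borel_measurable (lebesgue_on {0<..})" and bdd: "bounded (f ` {0<..})"
  obtains D where "D \<ge> 0" and "\<And>\<eta> \<epsilon> e. \<eta> > 0 \<Longrightarrow> \<epsilon> > 0 \<Longrightarrow> e \<ge> 0 \<Longrightarrow>
    \<forall>\<^sub>F w in at_top. \<forall>x>0. (\<forall>u. \<bar>u - ln x\<bar> \<le> \<eta> \<longrightarrow> \<bar>f (exp u) - f x\<bar> \<le> e) \<longrightarrow>
      \<bar>exp_kantorovich t chi w f x - f x\<bar> \<le> \<psi> e * D + \<epsilon>"
proof -
  have nn: "\<And>x. x > 0 \<Longrightarrow> 0 \<le> L x" and psi_nn: "\<And>u. u \<ge> 0 \<Longrightarrow> 0 \<le> \<psi> u"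
    and psi_mono: "mono_on {0..} \<psi>" and "\<alpha> > 0" and "\<beta> > 0"
    and chi_sum: "\<And>x u w. x > 0 \<Longrightarrow> w > 0 \<Longrightarrow>
      (\<lambda>k. \<bar>chi (exp (- t k) * x powr w) u\<bar>) summable_on UNIV"
    and chi_lip: "\<And>x u v. x > 0 \<Longrightarrow> \<bar>chi x u - chi x v\<bar> \<le> L x * \<psi> \<bar>u - v\<bar>"
    and S: "unif_bigo_powr (kernel_S t chi 1) \<alpha>" and T: "unif_bigo_powr (kernel_T t chi 1) \<alpha>"
    and L_bdd: "bounded (L ` {0<..})" and mfin: "discrete_moment \<beta> t L < \<infinity>"
    using ker unfolding nonlinear_kernel_def by auto
  obtain \<Delta> \<delta> where "\<Delta> > 0" "\<delta> > 0" and gap: "\<And>k. \<delta> \<le> t (k + 1) - t k"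
    and mesh: "\<And>k. t (k + 1) - t k \<le> \<Delta>" and t_less: "\<And>k. t k < t (k + 1)"
    using part unfolding sampling_partition_def by metis
  obtain M where "M \<ge> 0" and mom: "\<And>x F. x > 0 \<Longrightarrow> finite F \<Longrightarrow>
    (\<Sum>k\<in>F. L (exp (- t k) * x) * \<bar>ln x - t k\<bar> powr \<beta>) \<le> M"
    by (rule discrete_moment_finite_sum[OF mfin \<open>\<beta> > 0\<close>]) (erule nn, rule that, assumption, blast)
  obtain C where "C \<ge> 0" and const_err: "\<forall>\<^sub>F w in at_top. \<forall>x>0. \<forall>u.
    \<bar>(\<Sum>\<^sub>\<infinity>k\<in>UNIV. chi (exp (- t k) * x powr w) u) - u\<bar> \<le> (1 + \<bar>u\<bar>) * (C * w powr (- \<alpha>))"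
    by (rule kernel_constant_error[OF S T])
  obtain H where H: "\<And>x. x > 0 \<Longrightarrow> L x \<le> H"
    using L_bdd unfolding bounded_real by (auto dest: abs_le_D1)
  have "H \<ge> 0" using nn[of 1] H[of 1] by simp
  obtain A where A: "\<And>x. x > 0 \<Longrightarrow> \<bar>f x\<bar> \<le> A"
    using bdd unfolding bounded_real by auto
  have "A \<ge> 0" using A[of 1] by simp
  define D where "D = (2 / \<delta> + 1) * H + M"
  have "D \<ge> 0" using \<open>\<delta> > 0\<close> \<open>H \<ge> 0\<close> \<open>M \<ge> 0\<close> by (simp add: D_def)
  have sum_D: "(\<Sum>k\<in>F. L (exp (- t k) * y)) \<le> D" if "y > 0" "finite F" for y F
    unfolding D_def
    by (rule finite_sum_kernel_bound[where t = t]) (fact mom nn H gap \<open>\<beta> > 0\<close> \<open>\<delta> > 0\<close> that)+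
  have fexp: "(\<lambda>u. f (exp u)) \<in> borel_measurable lebesgue"
    by (rule borel_measurable_lebesgue_comp_exp[OF meas])
  have main: "\<forall>\<^sub>F w in at_top. \<forall>x>0. (\<forall>u. \<bar>u - ln x\<bar> \<le> \<eta> \<longrightarrow> \<bar>f (exp u) - f x\<bar> \<le> e) \<longrightarrow>
      \<bar>exp_kantorovich t chi w f x - f x\<bar> \<le> \<psi> e * D + \<epsilon>"
    if "\<eta> > 0" "\<epsilon> > 0" "e \<ge> 0" for \<eta> \<epsilon> e
  proof -
    have powr0: "((\<lambda>w. w powr (- s)) \<longlongrightarrow> 0) at_top" if "s > 0" for s :: real
      using tendsto_neg_powr[of "- s" "\<lambda>w. w" at_top] that by (simp add: filterlim_ident)
    have "filterlim (\<lambda>w. w * (\<eta> / 2)) at_top at_top"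
      using \<open>\<eta> > 0\<close> by (intro filterlim_at_top_mult_tendsto_pos[OF tendsto_const]) (auto simp: filterlim_ident)
    then have "((\<lambda>w. (w * (\<eta> / 2)) powr (- \<beta>)) \<longlongrightarrow> 0) at_top"
      using \<open>\<beta> > 0\<close> by (intro tendsto_neg_powr) auto
    \<comment> \<open>The two errors that vanish for large \<open>w\<close>: the far terms, where
      \<open>2 * A\<close> bounds \<open>\<bar>m k - f x\<bar>\<close>, and the error of the kernel
      on the constant \<open>f x\<close>. Together they make up \<open>\<epsilon>\<close>.\<close>
    then have "((\<lambda>w. \<psi> (2 * A) * (M * (w * (\<eta> / 2)) powr (- \<beta>)) + (1 + A) * (C * w powr (- \<alpha>))) \<longlongrightarrow>
        \<psi> (2 * A) * (M * 0) + (1 + A) * (C * 0)) at_top"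
      using powr0[OF \<open>\<alpha> > 0\<close>] by (intro tendsto_intros)
    then have "\<forall>\<^sub>F w in at_top.
        \<psi> (2 * A) * (M * (w * (\<eta> / 2)) powr (- \<beta>)) + (1 + A) * (C * w powr (- \<alpha>)) < \<epsilon>"
      using \<open>\<epsilon> > 0\<close> by (intro order_tendstoD) auto
    then show ?thesis
      using const_err eventually_gt_at_top[of 0] eventually_ge_at_top[of "2 * \<Delta> / \<eta>"]
    proof eventually_elim
      case (elim w)
      show ?case
      proof (intro allI impI)
        fix x :: real
        assume x: "x > 0" and near: "\<forall>u. \<bar>u - ln x\<bar> \<le> \<eta> \<longrightarrow> \<bar>f (exp u) - f x\<bar> \<le> e"
        \<comment> \<open>The threshold \<open>2 * \<Delta> / \<eta>\<close> is chosen so that each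
          rescaled cell has length at most \<open>\<eta> / 2\<close>.\<close>
        have w: "w > 0" and w\<Delta>: "\<Delta> \<le> w * (\<eta> / 2)"
          using elim \<open>\<eta> > 0\<close> by (auto simp: field_simps)
        define y where "y = x powr w"
        have y: "y > 0" "ln y = w * ln x" using x by (auto simp: y_def ln_powr)
        define m where "m k = w / (t (k + 1) - t k) * (LINT u:{t k / w..t (k + 1) / w}|lebesgue. f (exp u))" for k
        define r where "r = w * (\<eta> / 2)"
        have "r > 0" using w \<open>\<eta> > 0\<close> by (simp add: r_def)
        have mean: "\<bar>m k - f x\<bar> \<le> d"
          if "\<And>u. u \<in> {t k / w..t (k + 1) / w} \<Longrightarrow> \<bar>f (exp u) - f x\<bar> \<le> d" for k d
        proof -
          have "1 / (t (k + 1) / w - t k / w) = w / (t (k + 1) - t k)"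
            using w by (simp add: diff_divide_distrib[symmetric])
          moreover have "t k / w < t (k + 1) / w" using t_less w by (simp add: divide_strict_right_mono)
          ultimately show ?thesis
            using interval_mean_close[OF fexp, of A "t k / w" "t (k + 1) / w" "f x" d] A that
            by (simp add: m_def)
        qed
        have far_bound: "\<psi> \<bar>m k - f x\<bar> \<le> \<psi> (2 * A)" for k
        proof -
          have "\<bar>f (exp u) - f x\<bar> \<le> 2 * A" for u using A[of "exp u"] A[OF x] by simp
          then have "\<bar>m k - f x\<bar> \<le> 2 * A" by (rule mean)
          then show ?thesis using psi_mono \<open>A \<ge> 0\<close> by (auto intro: mono_onD)
        qed
        have near_bound: "\<psi> \<bar>m k - f x\<bar> \<le> \<psi> e" if k: "\<bar>ln y - t k\<bar> \<le> r" for k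
        proof -
          have "\<bar>f (exp u) - f x\<bar> \<le> e" if u: "u \<in> {t k / w..t (k + 1) / w}" for u
          proof -
            \<comment> \<open>After multiplication by \<open>w\<close>, the point \<open>u\<close>
              of the cell is within \<open>\<Delta> \<le> r\<close> of \<open>t k\<close>, which is
              within \<open>r\<close> of \<open>ln y = w * ln x\<close>. The total
              \<open>2 * r\<close> is \<open>w * \<eta>\<close>.\<close>
            have "t k \<le> w * u" "w * u \<le> t (k + 1)" using u w by (auto simp: field_simps)
            moreover have "w * \<eta> = 2 * r" by (simp add: r_def)
            ultimately have "\<bar>w * u - w * ln x\<bar> \<le> w * \<eta>"
              using k mesh[of k] w\<Delta>[folded r_def] unfolding y(2) by linarith
            then have "w * \<bar>u - ln x\<bar> \<le> w * \<eta>"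
              using w by (simp add: abs_mult right_diff_distrib[symmetric])
            then show ?thesis using near w by simp
          qed
          then have "\<bar>m k - f x\<bar> \<le> e" by (rule mean)
          then show ?thesis using psi_mono \<open>e \<ge> 0\<close> by (auto intro: mono_onD)
        qed
        let ?L = "\<lambda>k. L (exp (- t k) * y)"
        have L0: "?L k \<ge> 0" for k using nn y by simp
        have "(\<Sum>k\<in>F. \<bar>chi (exp (- t k) * y) (m k) - chi (exp (- t k) * y) (f x)\<bar>)
            \<le> \<psi> e * D + \<psi> (2 * A) * (M * r powr (- \<beta>))" if F: "finite F" for F
        proof -
          let ?G = "{k \<in> F. \<bar>ln y - t k\<bar> \<le> r}"
          have "(\<Sum>k\<in>F. \<bar>chi (exp (- t k) * y) (m k) - chi (exp (- t k) * y) (f x)\<bar>)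
              \<le> (\<Sum>k\<in>F. ?L k * \<psi> \<bar>m k - f x\<bar>)"
            using y by (intro sum_mono chi_lip) simp
          also have "\<dots> = (\<Sum>k\<in>F - ?G. ?L k * \<psi> \<bar>m k - f x\<bar>) + (\<Sum>k\<in>?G. ?L k * \<psi> \<bar>m k - f x\<bar>)"
            using F by (intro sum.subset_diff) auto
          also have "\<dots> \<le> (\<Sum>k\<in>F - ?G. ?L k * \<psi> (2 * A)) + (\<Sum>k\<in>?G. ?L k * \<psi> e)"
            using far_bound near_bound L0 by (intro add_mono sum_mono mult_left_mono) auto
          also have "\<dots> = \<psi> (2 * A) * (\<Sum>k\<in>F - ?G. ?L k) + \<psi> e * (\<Sum>k\<in>?G. ?L k)"
            by (simp add: sum_distrib_left mult.commute)
          also have "\<dots> \<le> \<psi> (2 * A) * (M * r powr (- \<beta>)) + \<psi> e * D"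
          proof (intro add_mono mult_left_mono)
            show "(\<Sum>k\<in>F - ?G. ?L k) \<le> M * r powr (- \<beta>)"
              by (rule finite_sum_kernel_far[where t = t])
                (use mom nn F \<open>r > 0\<close> \<open>\<beta> > 0\<close> y in auto)
            show "(\<Sum>k\<in>?G. ?L k) \<le> D" using F y by (intro sum_D) auto
          qed (use psi_nn \<open>A \<ge> 0\<close> \<open>e \<ge> 0\<close> in auto)
          finally show ?thesis by simp
        qed
        \<comment> \<open>The kernel assumption gives summability for a fixed second argument, here
          \<open>f x\<close>; the bound on finite sums just proved carries it over to the varying
          arguments \<open>m k\<close>.\<close>
        then have "\<bar>(\<Sum>\<^sub>\<infinity>k\<in>UNIV. chi (exp (- t k) * y) (m k)) - (\<Sum>\<^sub>\<infinity>k\<in>UNIV. chi (exp (- t k) * y) (f x))\<bar>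
            \<le> \<psi> e * D + \<psi> (2 * A) * (M * r powr (- \<beta>))"
          using chi_sum[OF x w] by (intro infsum_diff_le) (auto simp: y_def)
        moreover have "\<bar>(\<Sum>\<^sub>\<infinity>k\<in>UNIV. chi (exp (- t k) * y) (f x)) - f x\<bar> \<le> (1 + A) * (C * w powr (- \<alpha>))"
        proof -
          have "\<bar>(\<Sum>\<^sub>\<infinity>k\<in>UNIV. chi (exp (- t k) * y) (f x)) - f x\<bar> \<le> (1 + \<bar>f x\<bar>) * (C * w powr (- \<alpha>))"
            using elim x by (auto simp: y_def)
          also have "\<dots> \<le> (1 + A) * (C * w powr (- \<alpha>))"
            using A[OF x] \<open>C \<ge> 0\<close> by (intro mult_right_mono) auto
          finally show ?thesis .
        qed
        moreover have "exp_kantorovich t chi w f x = (\<Sum>\<^sub>\<infinity>k\<in>UNIV. chi (exp (- t k) * y) (m k))"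
          by (simp add: exp_kantorovich_def y_def m_def)
        ultimately show "\<bar>exp_kantorovich t chi w f x - f x\<bar> \<le> \<psi> e * D + \<epsilon>"
          using elim unfolding r_def by linarith
      qed
    qed
  qed
  show ?thesis using that[OF \<open>D \<ge> 0\<close> main] .
qed

section \<open>The two limits\<close>

lemma continuous_vanishing_small:
  fixes \<psi> :: "real \<Rightarrow> real"
  assumes "continuous_on {0..} \<psi>" and "\<psi> 0 = 0" and "D \<ge> 0" and "\<epsilon> > 0"
  obtains e where "e > 0" and "\<psi> e * D \<le> \<epsilon>"
proof -
  \<comment> \<open>Dividing by \<open>D + 1\<close> instead of \<open>D\<close> covers the case
    \<open>D = 0\<close>.\<close>
  have "\<epsilon> / (D + 1) > 0" using assms by simp
  then obtain d where d: "d > 0" "\<And>u. u \<ge> 0 \<Longrightarrow> \<bar>u\<bar> < d \<Longrightarrow> \<bar>\<psi> u\<bar> < \<epsilon> / (D + 1)"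
    using assms(1,2) unfolding continuous_on_iff dist_real_def
    by (metis (no_types, lifting) atLeast_iff diff_zero order_refl)
  have "\<psi> (d / 2) < \<epsilon> / (D + 1)" using d(1) d(2)[of "d / 2"] by simp
  then have "\<psi> (d / 2) * D \<le> \<epsilon> / (D + 1) * D"
    using \<open>D \<ge> 0\<close> by (intro mult_right_mono) auto
  also have "\<dots> \<le> \<epsilon>" using assms by (simp add: field_simps)
  finally show ?thesis using that[of "d / 2"] d(1) by simp
qed

theorem theorem6:
  fixes t :: "int \<Rightarrow> real" and L \<psi> :: "real \<Rightarrow> real" and \<alpha> \<beta> :: real
    and chi :: "real \<Rightarrow> real \<Rightarrow> real" and f :: "real \<Rightarrow> real"
  assumes "sampling_partition t"
    and "nonlinear_kernel t L \<psi> \<alpha> \<beta> chi"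
    and "f \<in> borel_measurable (lebesgue_on {0<..})"
    and "bounded (f ` {0<..})"
  shows "(\<forall>x>0. continuous (at x within {0<..}) f \<longrightarrow>
            ((\<lambda>w. exp_kantorovich t chi w f x) \<longlongrightarrow> f x) at_top) \<and>
         (f \<in> bounded_log_unif_cont \<longrightarrow>
            ((\<lambda>w. sup_norm (\<lambda>x. exp_kantorovich t chi w f x - f x)) \<longlongrightarrow> 0) at_top)"
proof -
  obtain D where "D \<ge> 0" and est: "\<And>\<eta> \<epsilon> e. \<eta> > 0 \<Longrightarrow> \<epsilon> > 0 \<Longrightarrow> e \<ge> 0 \<Longrightarrow>
    \<forall>\<^sub>F w in at_top. \<forall>x>0. (\<forall>u. \<bar>u - ln x\<bar> \<le> \<eta> \<longrightarrow> \<bar>f (exp u) - f x\<bar> \<le> e) \<longrightarrow>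
      \<bar>exp_kantorovich t chi w f x - f x\<bar> \<le> \<psi> e * D + \<epsilon>"
    by (rule exp_kantorovich_estimate[OF assms]) (rule that, assumption, blast)
  have psi: "continuous_on {0..} \<psi>" "\<psi> 0 = 0"
    using assms(2) unfolding nonlinear_kernel_def by auto
  have pointwise: "((\<lambda>w. exp_kantorovich t chi w f x) \<longlongrightarrow> f x) at_top"
    if x: "x > 0" and cont: "continuous (at x within {0<..}) f" for x
  proof (rule tendstoI)
    fix \<epsilon> :: real assume "\<epsilon> > 0"
    \<comment> \<open>Two thirds of \<open>\<epsilon>\<close> will be used, which leaves room for
      the strict inequality in the limit.\<close>
    then obtain e where e: "e > 0" "\<psi> e * D \<le> \<epsilon> / 3"
      using continuous_vanishing_small[OF psi \<open>D \<ge> 0\<close>, of "\<epsilon> / 3"] by auto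
    obtain d where d: "d > 0" "\<And>y. y > 0 \<Longrightarrow> \<bar>y - x\<bar> < d \<Longrightarrow> \<bar>f y - f x\<bar> < e"
      using cont e(1) unfolding continuous_within_eps_delta dist_real_def by fastforce
    have "isCont exp (ln x)" by simp
    then obtain s where s: "s > 0" "\<And>u. \<bar>u - ln x\<bar> < s \<Longrightarrow> \<bar>exp u - x\<bar> < d"
      using d(1) x unfolding continuous_at_eps_delta dist_real_def by fastforce
    \<comment> \<open>Halving \<open>s\<close> passes from the open neighbourhood given by
      continuity to the closed one in \<open>est\<close>.\<close>
    have "\<forall>u. \<bar>u - ln x\<bar> \<le> s / 2 \<longrightarrow> \<bar>f (exp u) - f x\<bar> \<le> e"
      using s d(2) by (auto intro!: less_imp_le)
    moreover have "\<forall>\<^sub>F w in at_top. \<forall>x>0. (\<forall>u. \<bar>u - ln x\<bar> \<le> s / 2 \<longrightarrow> \<bar>f (exp u) - f x\<bar> \<le> e) \<longrightarrow>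
        \<bar>exp_kantorovich t chi w f x - f x\<bar> \<le> \<psi> e * D + \<epsilon> / 3"
      using s e \<open>\<epsilon> > 0\<close> by (intro est) auto
    ultimately have "\<forall>\<^sub>F w in at_top. \<bar>exp_kantorovich t chi w f x - f x\<bar> \<le> \<psi> e * D + \<epsilon> / 3"
      using x by (auto elim: eventually_mono)
    then show "\<forall>\<^sub>F w in at_top. dist (exp_kantorovich t chi w f x) (f x) < \<epsilon>"
      by (rule eventually_mono) (use e \<open>\<epsilon> > 0\<close> in \<open>auto simp: dist_real_def\<close>)
  qed
  have uniform: "((\<lambda>w. sup_norm (\<lambda>x. exp_kantorovich t chi w f x - f x)) \<longlongrightarrow> 0) at_top"
    if f: "f \<in> bounded_log_unif_cont"
  proof (rule order_tendstoI)
    fix a :: ennreal assume "0 < a"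
    \<comment> \<open>\<open>a\<close> may be infinite, and a supremum inherits only a non-strict
      bound from its terms. An intermediate \<open>z\<close> settles both: it is a positive real,
      and a bound by \<open>z\<close> is strict with respect to \<open>a\<close>.\<close>
    then obtain z where z: "0 < z" "z < a" using dense by blast
    then obtain \<epsilon> where \<epsilon>: "z = ennreal \<epsilon>" "\<epsilon> > 0"
      by (cases z) (auto simp: top.not_eq_extremum)
    obtain e where e: "e > 0" "\<psi> e * D \<le> \<epsilon> / 2"
      using continuous_vanishing_small[OF psi \<open>D \<ge> 0\<close>, of "\<epsilon> / 2"] \<epsilon>(2) by auto
    obtain \<eta> where \<eta>: "\<eta> > 0" "\<And>u v. u > 0 \<Longrightarrow> v > 0 \<Longrightarrow> \<bar>ln u - ln v\<bar> \<le> \<eta> \<Longrightarrow> \<bar>f u - f v\<bar> < e"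
      using f e(1) unfolding bounded_log_unif_cont_def mem_Collect_eq by metis
    have "\<forall>x>0. \<forall>u. \<bar>u - ln x\<bar> \<le> \<eta> \<longrightarrow> \<bar>f (exp u) - f x\<bar> \<le> e"
      \<comment> \<open>Since \<open>ln (exp u) = u\<close>, log-uniform continuity gives one
        \<open>\<eta>\<close> for which the premise of \<open>est\<close> holds at every
        \<open>x > 0\<close>.\<close>
      using \<eta>(2)[of "exp _"] by (auto intro!: less_imp_le)
    moreover have "\<forall>\<^sub>F w in at_top. \<forall>x>0. (\<forall>u. \<bar>u - ln x\<bar> \<le> \<eta> \<longrightarrow> \<bar>f (exp u) - f x\<bar> \<le> e) \<longrightarrow>
        \<bar>exp_kantorovich t chi w f x - f x\<bar> \<le> \<psi> e * D + \<epsilon> / 2"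
      using \<eta> e \<epsilon> by (intro est) auto
    ultimately have "\<forall>\<^sub>F w in at_top. \<forall>x>0. \<bar>exp_kantorovich t chi w f x - f x\<bar> \<le> \<psi> e * D + \<epsilon> / 2"
      by (auto elim: eventually_mono)
    then show "\<forall>\<^sub>F w in at_top. sup_norm (\<lambda>x. exp_kantorovich t chi w f x - f x) < a"
    proof eventually_elim
      case (elim w)
      have "\<bar>exp_kantorovich t chi w f x - f x\<bar> \<le> \<epsilon>" if "x > 0" for x
      proof -
        have "\<bar>exp_kantorovich t chi w f x - f x\<bar> \<le> \<psi> e * D + \<epsilon> / 2" using elim that by blast
        also have "\<dots> \<le> \<epsilon>" using e by simp
        finally show ?thesis .
      qed
      then have "sup_norm (\<lambda>x. exp_kantorovich t chi w f x - f x) \<le> z"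
        unfolding sup_norm_def \<epsilon>(1) by (intro SUP_least ennreal_leI) auto
      then show ?case using z(2) by simp
    qed
  \<comment> \<open>What remains is the lower half of the order criterion, which is vacuous: no
    element of \<open>ennreal\<close> is below 0.\<close>
  qed auto
  show ?thesis using pointwise uniform by blast
qed

end
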